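(* Let $n\ge 1$ be an integer and suppose $f:X\to Y$ is a function of metric spaces that is coarsely $n$-to-1 and coarsely surjective. If $X$ has asymptotic property C, then $Y$ has asymptotic property C.
   Context: A function $f:X\to Y$ of metric spaces is bornologous if there is a function $E:[0,\infty)\to[0,\infty)$ such that the image of every subset of $X$ of diameter at most $r$ has diameter at most $E(r)$. A bornologous function $f:X\to Y$ is coarsely $n$-to-1 (with control $C$) if there is a function $C:[0,\infty)\to[0,\infty)$ such that for each subset $B$ of $Y$ with $\mathrm{diam}(B)\le r$ one has $f^{-1}(B)=\bigcup_{i=1}^n A_i$ for some subsets $A_i$ of $X$ with $\mathrm{diam}(A_i)<C(r)$ for $i=1,\dots,n$. (In particular a coarsely $n$-to-1 function is bornologous.) For $A\subset Y$ and $R>0$, $B(A,R)$ consists of $A$ and all points at distance less than $R$ from some point of $A$. $f:X\to Y$ is coarsely surjective if $Y\subset B(f(X),R)$ for some $R>0$. A family of subsets is $R$-disjoint if $d(x,y)\ge R$ whenever $x$ and $y$ belong to different elements of the family; it is uniformly bounded if the diameters of its members have a common finite upper bound. A metric space $X$ has asymptotic property C if for every sequence $R_1<R_2<\ldots$ of positive real numbers there exist $m\in\mathbb{N}$ and uniformly bounded families $\mathcal{U}_1,\dots,\mathcal{U}_m$ of subsets of $X$ such that $\mathcal{U}_i$ is $R_i$-disjoint for $1\le i\le m$ and the members of $\mathcal{U}_1,\dots,\mathcal{U}_m$ together cover $X$. *)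

theory Defs
  imports "HOL-Analysis.Analysis"
begin

text \<open>
  A metric space is a set X of points of a type of class \<^class>\<open>metric_space\<close>, with the
  restricted metric; in particular the empty space is included.

  Since \<^const>\<open>diameter\<close> is real-valued and carries no information about an unbounded set, the
  extended-real condition that the diameter of S is at most r is written
  \<^prop>\<open>bounded S \<and> diameter S \<le> r\<close>, and likewise for the strict inequality. Control functions
  from the half-line to itself are functions on the reals of which only the values at
  nonnegative arguments matter; those values are required to be nonnegative.
\<close>

definition bornologous_on ::
  "'a::metric_space set \<Rightarrow> ('a \<Rightarrow> 'b::metric_space) \<Rightarrow> bool" where
  "bornologous_on X f \<longleftrightarrow>
     (\<exists>E :: real \<Rightarrow> real. (\<forall>r\<ge>0. 0 \<le> E r) \<and>
        (\<forall>r\<ge>0. \<forall>S\<subseteq>X. bounded S \<and> diameter S \<le> r \<longrightarrow>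
           bounded (f ` S) \<and> diameter (f ` S) \<le> E r))"

definition coarsely_n_to_1 ::
  "nat \<Rightarrow> 'a::metric_space set \<Rightarrow> 'b::metric_space set \<Rightarrow> ('a \<Rightarrow> 'b) \<Rightarrow> bool" where
  "coarsely_n_to_1 n X Y f \<longleftrightarrow>
     bornologous_on X f \<and>
     (\<exists>C :: real \<Rightarrow> real. (\<forall>r\<ge>0. 0 \<le> C r) \<and>
        (\<forall>r\<ge>0. \<forall>B\<subseteq>Y. bounded B \<and> diameter B \<le> r \<longrightarrow>
           (\<exists>A :: nat \<Rightarrow> 'a set.
              {x\<in>X. f x \<in> B} = (\<Union>i\<in>{1..n}. A i) \<and>
              (\<forall>i\<in>{1..n}. A i \<subseteq> X \<and> bounded (A i) \<and> diameter (A i) < C r))))"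

definition nbhd_in :: "'a::metric_space set \<Rightarrow> 'a set \<Rightarrow> real \<Rightarrow> 'a set" where
  "nbhd_in Y A R = A \<union> {y\<in>Y. \<exists>a\<in>A. dist y a < R}"

definition coarsely_surjective ::
  "'a set \<Rightarrow> 'b::metric_space set \<Rightarrow> ('a \<Rightarrow> 'b) \<Rightarrow> bool" where
  "coarsely_surjective X Y f \<longleftrightarrow> (\<exists>R>0. Y \<subseteq> nbhd_in Y (f ` X) R)"

definition R_disjoint :: "real \<Rightarrow> 'a::metric_space set set \<Rightarrow> bool" where
  "R_disjoint R \<U> \<longleftrightarrow>
     (\<forall>U\<in>\<U>. \<forall>V\<in>\<U>. U \<noteq> V \<longrightarrow> (\<forall>x\<in>U. \<forall>y\<in>V. R \<le> dist x y))"

definition uniformly_bounded_family :: "'a::metric_space set set \<Rightarrow> bool" where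
  "uniformly_bounded_family \<U> \<longleftrightarrow> (\<exists>D. \<forall>U\<in>\<U>. bounded U \<and> diameter U \<le> D)"

text \<open>The sequence \<open>R\<close> is indexed from 1; its value at 0 is irrelevant.\<close>

definition asymptotic_property_C :: "'a::metric_space set \<Rightarrow> bool" where
  "asymptotic_property_C X \<longleftrightarrow>
     (\<forall>R :: nat \<Rightarrow> real. (\<forall>i\<ge>1. 0 < R i) \<and> (\<forall>i\<ge>1. R i < R (Suc i)) \<longrightarrow>
        (\<exists>(m::nat) (\<U> :: nat \<Rightarrow> 'a set set).
           (\<forall>i\<in>{1..m}. (\<forall>U\<in>\<U> i. U \<subseteq> X) \<and>
              uniformly_bounded_family (\<U> i) \<and> R_disjoint (R i) (\<U> i)) \<and>
           X \<subseteq> (\<Union>i\<in>{1..m}. \<Union>(\<U> i))))"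

end

theory Submission
  imports Defs
begin

text \<open>
  Let \<open>\<U>\<close> be a uniformly bounded, \<open>S\<close>-disjoint family in \<open>X\<close>. The preimage of a set of diameter
  at most \<open>s\<close> is a union of \<open>n\<close> sets of diameter less than \<open>C s\<close>, so if \<open>S \<ge> C s\<close> then every ball
  of radius \<open>s / 2\<close> in \<open>Y\<close> meets at most \<open>n\<close> of the images \<open>f ` U\<close>. Let every point of
  \<open>Y\<close> lie within \<open>r\<close> of \<open>f ` X\<close>. For \<open>y\<close> within \<open>r\<close> of the union of the images, consider the
  sets \<open>T j y\<close> of those images at distance less than \<open>r + j * \<delta>\<close> from \<open>y\<close>, for \<open>j = 0, \<dots>, n\<close>.
  They increase with \<open>j\<close>, and their cardinalities lie in \<open>{1..n}\<close>, so \<open>T j y = T (j + 1) y\<close>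
  for some \<open>j < n\<close>. For fixed \<open>j\<close>, sorting these points by the value of \<open>T j y\<close> yields a
  \<open>\<delta>\<close>-disjoint family, so \<open>\<U>\<close> is traded for \<open>n\<close> \<open>\<delta>\<close>-disjoint families in \<open>Y\<close>. If the \<open>i\<close>-th
  family in \<open>X\<close> is treated with \<open>\<delta> = R (n * i)\<close>, the resulting \<open>n * m\<close> families, taken in order,
  are as disjoint as property C requires.
\<close>

section \<open>Diameter bounds and stabilizing chains of sets\<close>

lemma bounded_diameter_le:
  fixes S :: "'a::metric_space set"
  assumes "0 \<le> d" and le: "\<And>x y. x \<in> S \<Longrightarrow> y \<in> S \<Longrightarrow> dist x y \<le> d"
  shows "bounded S \<and> diameter S \<le> d"
proof
  show "bounded S"
    unfolding bounded_two_points using le by blast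
  show "diameter S \<le> d"
    using assms by (auto simp: diameter_def intro!: cSUP_least)
qed

text \<open>If all \<open>n\<close> inclusions were strict, the cardinality, at least 1 at the
  start, would exceed \<open>n\<close> at \<open>T n\<close>.\<close>

lemma increasing_sets_stabilize:
  fixes T :: "nat \<Rightarrow> 'a set"
  assumes mono: "\<And>j. T j \<subseteq> T (Suc j)" and "finite (T n)" "card (T n) \<le> n" "T 0 \<noteq> {}"
  shows "\<exists>j<n. T j = T (Suc j)"
proof (rule ccontr)
  assume "\<not> ?thesis"
  then have strict: "T j \<subset> T (Suc j)" if "j < n" for j
    using mono that by blast
  have fin: "finite (T j)" if "j \<le> n" for j
    using lift_Suc_mono_le[of T, OF mono that] \<open>finite (T n)\<close> by (rule finite_subset)
  have "Suc j \<le> card (T j)" if "j \<le> n" for j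
    using that
  proof (induction j)
    case 0
    then show ?case
      using fin[of 0] \<open>T 0 \<noteq> {}\<close> by (simp add: Suc_le_eq card_gt_0_iff)
  next
    case (Suc j)
    then show ?case
      using psubset_card_mono[OF fin[of "Suc j"] strict[of j]] by simp
  qed
  from this[of n] show False
    using \<open>card (T n) \<le> n\<close> by simp
qed

section \<open>Disjoint families from bounded multiplicity\<close>

definition near :: "'a::metric_space set set \<Rightarrow> real \<Rightarrow> 'a \<Rightarrow> 'a set set" where
  "near \<W> t y = {W\<in>\<W>. \<exists>w\<in>W. dist y w < t}"

lemma near_mono: "s \<le> t \<Longrightarrow> near \<W> s y \<subseteq> near \<W> t y"
  unfolding near_def by force

lemma R_disjoint_families_of_multiplicity:
  fixes Y :: "'a::metric_space set" and \<W> :: "'a set set"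
  assumes "0 < r" "0 < \<delta>"
    and bdd: "uniformly_bounded_family \<W>"
    and mult: "\<And>y. y \<in> Y \<Longrightarrow> finite (near \<W> (r + real n * \<delta>) y)
                  \<and> card (near \<W> (r + real n * \<delta>) y) \<le> n"
  obtains \<V> :: "nat \<Rightarrow> 'a set set" where
    "\<And>j V. V \<in> \<V> j \<Longrightarrow> V \<subseteq> Y"
    "\<And>j. uniformly_bounded_family (\<V> j)"
    "\<And>j. R_disjoint \<delta> (\<V> j)"
    "\<And>y. y \<in> Y \<Longrightarrow> near \<W> r y \<noteq> {} \<Longrightarrow> \<exists>j<n. y \<in> \<Union>(\<V> j)"
proof -
  define \<tau> where "\<tau> j = r + real j * \<delta>" for j
  \<comment> \<open>Asking for the same value at two consecutive scales leaves a gap of width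
    \<open>\<delta>\<close> between the members of \<open>\<W>\<close> in \<open>T\<close> and the
    others.\<close>
  define P where "P j T = {y\<in>Y. near \<W> (\<tau> j) y = T \<and> near \<W> (\<tau> (Suc j)) y = T}" for j T
  \<comment> \<open>The empty \<open>T\<close> is excluded: the points far from every member may
    form an unbounded set.\<close>
  define \<V> where "\<V> j = P j ` {T. T \<noteq> {}}" for j
  have \<tau>_Suc: "\<tau> (Suc j) = \<tau> j + \<delta>" for j
    by (simp add: \<tau>_def algebra_simps)
  have \<tau>_pos: "0 < \<tau> j" for j
    using \<open>0 < r\<close> \<open>0 < \<delta>\<close> by (simp add: \<tau>_def add_pos_nonneg)
  obtain D where D: "\<And>W. W \<in> \<W> \<Longrightarrow> bounded W \<and> diameter W \<le> D"
    using bdd unfolding uniformly_bounded_family_def by auto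
  \<comment> \<open>\<open>W\<close> has a point closer than \<open>\<tau> j\<close> to
    \<open>y\<close>, but none closer than \<open>\<tau> j + \<delta>\<close> to
    \<open>z\<close>.\<close>
  have far: "\<delta> \<le> dist y z"
    if *: "y \<in> P j T" "z \<in> P j T'" "W \<in> T" "W \<notin> T'" for j T T' W y z
  proof -
    obtain w where w: "W \<in> \<W>" "w \<in> W" "dist y w < \<tau> j"
      using * by (auto simp: P_def near_def)
    have "W \<notin> near \<W> (\<tau> (Suc j)) z"
      using * by (simp add: P_def)
    then have "\<not> dist z w < \<tau> (Suc j)"
      using w unfolding near_def by blast
    moreover have "dist z w \<le> dist y z + dist y w"
      by (metis dist_commute dist_triangle)
    ultimately show ?thesis
      using w \<tau>_Suc[of j] by linarith
  qed
  show ?thesis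
  proof
    show "V \<subseteq> Y" if "V \<in> \<V> j" for j V
      using that by (auto simp: \<V>_def P_def)
    show "R_disjoint \<delta> (\<V> j)" for j
      unfolding R_disjoint_def
    proof (intro ballI impI)
      fix U V y z assume *: "U \<in> \<V> j" "V \<in> \<V> j" "U \<noteq> V" "y \<in> U" "z \<in> V"
      then obtain T T' where T: "U = P j T" "V = P j T'" "T \<noteq> T'"
        by (auto simp: \<V>_def)
      then obtain W where "W \<in> T \<and> W \<notin> T' \<or> W \<in> T' \<and> W \<notin> T"
        by blast
      then show "\<delta> \<le> dist y z"
        using far[of y j T z T' W] far[of z j T' y T W] * T by (auto simp: dist_commute)
    qed
    show "uniformly_bounded_family (\<V> j)" for j
      unfolding uniformly_bounded_family_def
    proof (intro exI ballI)
      fix V assume "V \<in> \<V> j"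
      then obtain T W where T: "V = P j T" "W \<in> T"
        by (auto simp: \<V>_def)
      \<comment> \<open>One \<open>W\<close> in \<open>T\<close> is near all points of
        \<open>V\<close> and links any two of them; \<open>max D 0\<close> keeps the bound
        nonnegative even for empty \<open>V\<close>.\<close>
      have dist_le: "dist y z \<le> 2 * \<tau> j + max D 0" if *: "y \<in> V" "z \<in> V" for y z
      proof -
        have "W \<in> near \<W> (\<tau> j) y" "W \<in> near \<W> (\<tau> j) z"
          using * T by (simp_all add: P_def)
        then obtain a b where "W \<in> \<W>" and a: "a \<in> W" "dist y a < \<tau> j"
          and b: "b \<in> W" "dist z b < \<tau> j"
          unfolding near_def by blast
        then have "dist a b \<le> D"
          using diameter_bounded_bound[of W a b] D[of W] by force
        moreover have "dist y z \<le> dist y a + dist a b + dist z b"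
          using dist_triangle[of y z a] dist_triangle[of a z b] by (simp add: dist_commute)
        ultimately show ?thesis
          using a b by linarith
      qed
      show "bounded V \<and> diameter V \<le> 2 * \<tau> j + max D 0"
        using \<tau>_pos[of j] by (intro bounded_diameter_le dist_le) auto
    qed
    show "\<exists>j<n. y \<in> \<Union>(\<V> j)" if *: "y \<in> Y" "near \<W> r y \<noteq> {}" for y
    proof -
      have mono: "near \<W> (\<tau> j) y \<subseteq> near \<W> (\<tau> (Suc j)) y" for j
        using \<tau>_Suc \<open>0 < \<delta>\<close> by (intro near_mono) simp
      \<comment> \<open>The chain starts at scale \<open>r\<close>, where it is nonempty, and ends
        at the scale of the multiplicity bound.\<close>
      obtain j where "j < n" "near \<W> (\<tau> j) y = near \<W> (\<tau> (Suc j)) y"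
        using increasing_sets_stabilize[of "\<lambda>j. near \<W> (\<tau> j) y" n] mono mult *
        by (auto simp: \<tau>_def)
      moreover have "near \<W> (\<tau> 0) y \<subseteq> near \<W> (\<tau> j) y"
        using \<open>0 < \<delta>\<close> by (intro near_mono) (simp add: \<tau>_def)
      ultimately have "y \<in> P j (near \<W> (\<tau> j) y)" "near \<W> (\<tau> j) y \<noteq> {}"
        using * by (auto simp: P_def \<tau>_def)
      then show ?thesis
        using \<open>j < n\<close> by (auto simp: \<V>_def)
    qed
  qed
qed

section \<open>Images of families under a coarsely n-to-1 map\<close>

text \<open>Each member of \<open>\<U>\<close> meeting the preimage of the ball meets some
  \<open>A i\<close>. Distinct members cannot share an index, since \<open>A i\<close> has diameter
  below \<open>S\<close>.\<close>

lemma card_near_image_le: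
  fixes f :: "'a::metric_space \<Rightarrow> 'b::metric_space"
  assumes cover: "{x\<in>X. f x \<in> ball y t} \<subseteq> (\<Union>i\<in>{1..n}. A i)"
    and small: "\<And>i. i \<in> {1..n} \<Longrightarrow> bounded (A i) \<and> diameter (A i) < S"
    and "R_disjoint S \<U>" and "\<And>U. U \<in> \<U> \<Longrightarrow> U \<subseteq> X"
  shows "finite (near ((`) f ` \<U>) t y) \<and> card (near ((`) f ` \<U>) t y) \<le> n"
proof -
  \<comment> \<open>Members are counted before taking images; coinciding images only lower the
    count.\<close>
  define M where "M = {U\<in>\<U>. \<exists>x\<in>U. dist y (f x) < t}"
  have "\<exists>i\<in>{1..n}. U \<inter> A i \<noteq> {}" if *: "U \<in> M" for U
  proof -
    obtain x where "x \<in> U" "dist y (f x) < t" "U \<in> \<U>"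
      using * by (auto simp: M_def)
    then have "x \<in> {x\<in>X. f x \<in> ball y t}"
      using assms(4)[of U] by auto
    then have "x \<in> (\<Union>i\<in>{1..n}. A i)"
      using cover by blast
    then show ?thesis
      using \<open>x \<in> U\<close> by blast
  qed
  then obtain p where p: "\<And>U. U \<in> M \<Longrightarrow> p U \<in> {1..n} \<and> U \<inter> A (p U) \<noteq> {}"
    by metis
  have "inj_on p M"
  proof (rule inj_onI, rule ccontr)
    fix U V assume *: "U \<in> M" "V \<in> M" "p U = p V" "U \<noteq> V"
    obtain a b where ab: "a \<in> U" "a \<in> A (p U)" "b \<in> V" "b \<in> A (p U)"
      using p[of U] p[of V] * by auto
    have "dist a b < S"
      using diameter_bounded_bound[of "A (p U)" a b] small[of "p U"] p[of U] * ab by auto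
    moreover have "S \<le> dist a b"
      using \<open>R_disjoint S \<U>\<close> * ab by (auto simp: R_disjoint_def M_def)
    ultimately show False
      by simp
  qed
  moreover have "p ` M \<subseteq> {1..n}"
    using p by blast
  ultimately have M: "finite M" "card M \<le> n"
    using card_inj_on_le[of p M "{1..n}"] inj_on_finite[of p M "{1..n}"] by auto
  have "near ((`) f ` \<U>) t y = (`) f ` M"
    by (auto simp: near_def M_def)
  then show ?thesis
    using M card_image_le[of M "(`) f"] by simp
qed

lemma uniformly_bounded_family_image:
  assumes "bornologous_on X f" "uniformly_bounded_family \<U>" "\<And>U. U \<in> \<U> \<Longrightarrow> U \<subseteq> X"
  shows "uniformly_bounded_family ((`) f ` \<U>)"
proof -
  obtain E where E: "\<forall>r\<ge>0. \<forall>S\<subseteq>X. bounded S \<and> diameter S \<le> r \<longrightarrow>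
      bounded (f ` S) \<and> diameter (f ` S) \<le> E r"
    using assms(1) unfolding bornologous_on_def by (elim exE conjE)
  obtain D where D: "\<And>U. U \<in> \<U> \<Longrightarrow> bounded U \<and> diameter U \<le> D"
    using assms(2) unfolding uniformly_bounded_family_def by auto
  have "bounded (f ` U) \<and> diameter (f ` U) \<le> E (max D 0)" if "U \<in> \<U>" for U
  proof -
    have "diameter U \<le> max D 0"
      using D[OF that] by linarith
    then show ?thesis
      using E[rule_format, of "max D 0" U] D[OF that] assms(3)[OF that] by simp
  qed
  then show ?thesis
    unfolding uniformly_bounded_family_def by auto
qed

section \<open>Property C of the codomain\<close>

theorem theorem6p2:
  fixes X :: "'a::metric_space set" and Y :: "'b::metric_space set"
    and f :: "'a \<Rightarrow> 'b" and n :: nat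
  assumes "1 \<le> n"
    and "f ` X \<subseteq> Y"
    and "coarsely_n_to_1 n X Y f"
    and "coarsely_surjective X Y f"
    and "asymptotic_property_C X"
  shows "asymptotic_property_C Y"
  unfolding asymptotic_property_C_def
proof (intro allI impI, elim conjE)
  fix R :: "nat \<Rightarrow> real"
  assume R_pos: "\<forall>i\<ge>1. 0 < R i" and R_less: "\<forall>i\<ge>1. R i < R (Suc i)"
  have R_mono: "R i \<le> R j" if "1 \<le> i" "i \<le> j" for i j
    using that(2,1)
  proof (induction rule: dec_induct)
    case (step k)
    then show ?case
      using R_less[rule_format, of k] by simp
  qed simp
  have born: "bornologous_on X f"
    using assms(3) unfolding coarsely_n_to_1_def by blast
  obtain C :: "real \<Rightarrow> real" where C_nonneg: "\<forall>r\<ge>0. 0 \<le> C r"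
    and C: "\<forall>r\<ge>0. \<forall>B\<subseteq>Y. bounded B \<and> diameter B \<le> r \<longrightarrow>
      (\<exists>A :: nat \<Rightarrow> 'a set. {x\<in>X. f x \<in> B} = (\<Union>i\<in>{1..n}. A i) \<and>
        (\<forall>i\<in>{1..n}. A i \<subseteq> X \<and> bounded (A i) \<and> diameter (A i) < C r))"
    using assms(3) unfolding coarsely_n_to_1_def by (elim exE conjE)
  obtain r where "0 < r" and r: "Y \<subseteq> nbhd_in Y (f ` X) r"
    using assms(4) unfolding coarsely_surjective_def by blast
  define \<delta> where "\<delta> i = R (n * i)" for i
  \<comment> \<open>The largest scale examined for family \<open>i\<close>; a ball of this radius
    has diameter at most \<open>2 * t i\<close>, the argument of \<open>C\<close> below.\<close>
  define t where "t i = r + real n * \<delta> i" for i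
  \<comment> \<open>\<open>C\<close> need not be monotone: the sum of its nonnegative values
    dominates each of them, and \<open>real i\<close> makes \<open>S\<close> strictly
    increasing.\<close>
  define S where "S i = real i + (\<Sum>k=1..i. C (2 * t k))" for i
  have \<delta>_pos: "0 < \<delta> i" if "1 \<le> i" for i
    using R_pos \<open>1 \<le> n\<close> that by (simp add: \<delta>_def)
  have t_pos: "0 < t i" if "1 \<le> i" for i
    using \<delta>_pos[OF that] \<open>0 < r\<close> by (simp add: t_def add_pos_nonneg)
  have Ct_nonneg: "0 \<le> C (2 * t i)" if "1 \<le> i" for i
    using t_pos[OF that] C_nonneg by simp
  have S_ge: "C (2 * t i) \<le> S i" if "1 \<le> i" for i
  proof -
    have "C (2 * t i) \<le> (\<Sum>k=1..i. C (2 * t k))"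
      using that Ct_nonneg by (intro member_le_sum) auto
    then show ?thesis
      by (simp add: S_def)
  qed
  have "\<forall>i\<ge>1. 0 < S i"
    using Ct_nonneg by (auto simp: S_def intro!: add_pos_nonneg sum_nonneg)
  moreover have "\<forall>i\<ge>1. S i < S (Suc i)"
    using Ct_nonneg by (auto simp: S_def intro!: add_pos_nonneg)
  ultimately obtain m and \<U> :: "nat \<Rightarrow> 'a set set" where
    \<U>: "\<And>i. i \<in> {1..m} \<Longrightarrow> (\<forall>U\<in>\<U> i. U \<subseteq> X) \<and>
          uniformly_bounded_family (\<U> i) \<and> R_disjoint (S i) (\<U> i)"
    and cover: "X \<subseteq> (\<Union>i\<in>{1..m}. \<Union>(\<U> i))"
    using assms(5) unfolding asymptotic_property_C_def by metis
  define \<W> where "\<W> i = (`) f ` \<U> i" for i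
  have "\<exists>\<V> :: nat \<Rightarrow> 'b set set. (\<forall>j. \<forall>V\<in>\<V> j. V \<subseteq> Y) \<and> (\<forall>j. uniformly_bounded_family (\<V> j)) \<and>
      (\<forall>j. R_disjoint (\<delta> i) (\<V> j)) \<and>
      (\<forall>y\<in>Y. near (\<W> i) r y \<noteq> {} \<longrightarrow> (\<exists>j<n. y \<in> \<Union>(\<V> j)))" if i: "i \<in> {1..m}" for i
  proof -
    have mult: "finite (near (\<W> i) (t i) y) \<and> card (near (\<W> i) (t i) y) \<le> n" if "y \<in> Y" for y
    proof -
      \<comment> \<open>\<open>C\<close> controls subsets of \<open>Y\<close> only; since
        \<open>f\<close> maps \<open>X\<close> into \<open>Y\<close>, the intersection does not
        change the preimage.\<close>
      have "bounded (ball y (t i) \<inter> Y) \<and> diameter (ball y (t i) \<inter> Y) \<le> 2 * t i"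
      proof (rule bounded_diameter_le)
        show "0 \<le> 2 * t i"
          using t_pos[of i] i by simp
        show "dist a b \<le> 2 * t i" if "a \<in> ball y (t i) \<inter> Y" "b \<in> ball y (t i) \<inter> Y" for a b
          using that dist_triangle3[of a b y] by simp
      qed
      then obtain A :: "nat \<Rightarrow> 'a set" where
        A: "{x\<in>X. f x \<in> ball y (t i) \<inter> Y} = (\<Union>k\<in>{1..n}. A k)"
          "\<forall>k\<in>{1..n}. A k \<subseteq> X \<and> bounded (A k) \<and> diameter (A k) < C (2 * t i)"
        using C[rule_format, of "2 * t i" "ball y (t i) \<inter> Y"] t_pos[of i] i by auto
      show ?thesis
        unfolding \<W>_def
      proof (rule card_near_image_le)
        show "{x\<in>X. f x \<in> ball y (t i)} \<subseteq> (\<Union>k\<in>{1..n}. A k)"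
          unfolding A(1)[symmetric] using assms(2) by auto
        show "bounded (A k) \<and> diameter (A k) < S i" if "k \<in> {1..n}" for k
          using A(2) that S_ge[of i] i by force
      qed (use \<U>[OF i] in auto)
    qed
    have "uniformly_bounded_family (\<W> i)"
      unfolding \<W>_def using uniformly_bounded_family_image[OF born] \<U>[OF i] by blast
    then obtain \<V> :: "nat \<Rightarrow> 'b set set" where
      "\<And>j V. V \<in> \<V> j \<Longrightarrow> V \<subseteq> Y" "\<And>j. uniformly_bounded_family (\<V> j)"
      "\<And>j. R_disjoint (\<delta> i) (\<V> j)"
      "\<And>y. y \<in> Y \<Longrightarrow> near (\<W> i) r y \<noteq> {} \<Longrightarrow> \<exists>j<n. y \<in> \<Union>(\<V> j)"
      using R_disjoint_families_of_multiplicity[OF \<open>0 < r\<close> \<delta>_pos[of i], of "\<W> i" Y n]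
        i mult unfolding t_def by auto
    then show ?thesis
      by (intro exI[of _ \<V>]) blast
  qed
  then obtain \<V> :: "nat \<Rightarrow> nat \<Rightarrow> 'b set set" where
    \<V>: "\<And>i. i \<in> {1..m} \<Longrightarrow> (\<forall>j. \<forall>V\<in>\<V> i j. V \<subseteq> Y) \<and> (\<forall>j. uniformly_bounded_family (\<V> i j)) \<and>
      (\<forall>j. R_disjoint (\<delta> i) (\<V> i j)) \<and>
      (\<forall>y\<in>Y. near (\<W> i) r y \<noteq> {} \<longrightarrow> (\<exists>j<n. y \<in> \<Union>(\<V> i j)))"
    by metis
  \<comment> \<open>The pair \<open>i\<close>, \<open>j\<close> has number
    \<open>(i - 1) * n + j + 1\<close>, with \<open>i\<close> counted from 1 and \<open>j\<close>
    from 0, so block \<open>i\<close> ends at \<open>n * i\<close>; this inverts the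
    numbering.\<close>
  define idx where "idx k = Suc ((k - 1) div n)" for k
  define \<V>' where "\<V>' k = \<V> (idx k) ((k - 1) mod n)" for k
  have idx: "idx k \<in> {1..m}" "k \<le> n * idx k" if "k \<in> {1..n * m}" for k
  proof -
    have "(k - 1) div n < m"
      using that \<open>1 \<le> n\<close> by (intro less_mult_imp_div_less) (auto simp: mult.commute)
    then show "idx k \<in> {1..m}"
      by (simp add: idx_def)
    have "k - 1 < n + n * ((k - 1) div n)"
      using \<open>1 \<le> n\<close> by (intro dividend_less_times_div) simp
    then show "k \<le> n * idx k"
      unfolding idx_def mult_Suc_right by linarith
  qed
  have "R_disjoint (R k) (\<V>' k)" if "k \<in> {1..n * m}" for k
  proof -
    have "R k \<le> \<delta> (idx k)"
      unfolding \<delta>_def using idx(2)[OF that] that by (intro R_mono) auto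
    then show ?thesis
      using \<V>[OF idx(1)[OF that]] unfolding \<V>'_def R_disjoint_def by (meson order_trans)
  qed
  then have "\<forall>k\<in>{1..n * m}. (\<forall>V\<in>\<V>' k. V \<subseteq> Y) \<and>
      uniformly_bounded_family (\<V>' k) \<and> R_disjoint (R k) (\<V>' k)"
    using \<V>[OF idx(1)] unfolding \<V>'_def by blast
  moreover have "Y \<subseteq> (\<Union>k\<in>{1..n * m}. \<Union>(\<V>' k))"
  proof
    fix y assume "y \<in> Y"
    \<comment> \<open>A point of the image is at distance 0 from it, so both parts of the
      neighbourhood give such an \<open>x\<close>.\<close>
    then obtain x where x: "x \<in> X" "dist y (f x) < r"
      using r \<open>0 < r\<close> unfolding nbhd_in_def by fastforce
    then obtain i U where i: "i \<in> {1..m}" "U \<in> \<U> i" "x \<in> U"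
      using cover by blast
    then have "near (\<W> i) r y \<noteq> {}"
      using x by (auto simp: near_def \<W>_def)
    then obtain j where j: "j < n" "y \<in> \<Union>(\<V> i j)"
      using \<V>[OF i(1)] \<open>y \<in> Y\<close> by blast
    define k where "k = Suc ((i - 1) * n + j)"
    have "(i - 1) * n + j < (i - 1) * n + n"
      using j by simp
    also have "\<dots> = n * i"
      using i by (cases i) auto
    also have "\<dots> \<le> n * m"
      using i by simp
    finally have "k \<in> {1..n * m}"
      by (simp add: k_def)
    moreover have "\<V>' k = \<V> i j"
      using i j by (simp add: \<V>'_def idx_def k_def)
    ultimately show "y \<in> (\<Union>k\<in>{1..n * m}. \<Union>(\<V>' k))"
      using j by blast
  qed
  ultimately show "\<exists>m \<U>. (\<forall>i\<in>{1..m}. (\<forall>U\<in>\<U> i. U \<subseteq> Y) \<and>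
      uniformly_bounded_family (\<U> i) \<and> R_disjoint (R i) (\<U> i)) \<and> Y \<subseteq> (\<Union>i\<in>{1..m}. \<Union>(\<U> i))"
    by blast
qed

end
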